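(* Let $\mathbb{K}$ be $\mathbb{Q}$ or $\mathbb{F}_p$ for a prime $p$, with $\mathrm{char}(\mathbb{K})\neq 2$, and let $h,t,\tilde h,\tilde t\in\mathbb{K}$. Suppose $h^2+4t\neq 0$ and $\dfrac{\tilde h^2+4\tilde t}{h^2+4t}=a^2$ for some non-zero $a\in\mathbb{K}$. Let $L$ be an oriented link and let $\Theta: U_{\tilde h,\tilde t}^{*}(L;\mathbb{K})\to U_{h,t}^{*}(L;\mathbb{K})$ be the twist equivalence isomorphism determined by $a$ (defined in the context). Then $\Theta$ preserves the $s$-grading: for every non-zero class $\alpha\in U_{\tilde h,\tilde t}^{i}(L;\mathbb{K})$, $$s(\alpha,\mathbb{K})_{\tilde h,\tilde t}=s(\Theta(\alpha),\mathbb{K})_{h,t}.$$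
   Context: For $h,t\in\mathbb{K}$, $A_{h,t}=\mathbb{K}[x]/(x^2-hx-t)$ is the Frobenius system over $\mathbb{K}$ with coproduct $\Delta(1)=1\otimes x+x\otimes 1-h\,1\otimes 1$, $\Delta(x)=x\otimes x+t\,1\otimes 1$ and counit $\epsilon(1)=0$, $\epsilon(x)=1$. Link homology: let $D$ be a diagram of the oriented link $L$ with $m$ ordered crossings, $c^+$ of them positive and $c^-$ negative. Each crossing has a $0$-smoothing and a $1$-smoothing, with the convention that the orientation-preserving smoothing is the $0$-smoothing of a positive crossing and the $1$-smoothing of a negative crossing. For $v\in\{0,1\}^m$ let $D_v$ be the resulting collection of $k_v$ circles and put $|v|=\sum_j v_j$. Let $C_{h,t}^i(L)=\bigoplus_{|v|=i+c^-}A_{h,t}^{\otimes k_v}$ (tensor factors indexed by the circles of $D_v$). The differential $C_{h,t}^i(L)\to C_{h,t}^{i+1}(L)$ is the sum over edges $v\to v'$ (one coordinate, the $j$-th, changes from $0$ to $1$) of $(-1)^{v_1+\cdots+v_{j-1}}$ times the map which is multiplication $A_{h,t}\otimes A_{h,t}\to A_{h,t}$ if two circles merge, $\Delta$ if one circle splits, and the identity on the other factors. Its cohomology is $U_{h,t}^{*}(L;\mathbb{K})$. The diagram $D$ is fixed, and the same one is used for $(h,t)$ and $(\tilde h,\tilde t)$. The $s$-grading: set $p(1)=1$, $p(x)=-1$, and for $w=w_1\otimes\cdots\otimes w_k\in A_{h,t}^{\otimes k}$ with $w_j\in\{1,x\}$ set $p(w)=p(w_1)+\cdots+p(w_k)$.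 A general non-zero chain $w$ is written as $w=w^1+\cdots+w^l$ with the $w^j$ non-zero and homogeneous with respect to $p$ of distinct degrees (linear combinations of such basis tensors of equal $p$), and $p(w)=\min_j p(w^j)$. For $0\neq w\in C_{h,t}^i(L)$ set $q(w)=p(w)+i+c^+-c^-$. For a non-zero class $\alpha\in U_{h,t}^{i}(L;\mathbb{K})$, $$s(\alpha,\mathbb{K})_{h,t}=\max\{q(w)\mid w\in C_{h,t}^i(L)\text{ a cocycle with }[w]=\alpha\}.$$ The same definitions are used for $(\tilde h,\tilde t)$, with the generator of $A_{\tilde h,\tilde t}$ denoted $y$ instead of $x$. The twist equivalence: the twist of a Frobenius system $A$ by an invertible $\theta\in A$ has the same ring and unit map, coproduct $\Delta'(c)=\Delta(\theta^{-1}c)$ and counit $\epsilon'(c)=\epsilon(\theta c)$. Let $b=\tfrac12(\tilde h-ah)$ and let $A'_{h,t}$ be the twist of $A_{h,t}$ by $a^{-1}$ (so $\Delta'=a\Delta$). The map $g:A_{\tilde h,\tilde t}\to A'_{h,t}$, $1\mapsto 1$, $y\mapsto ax+b$, is an isomorphism of Frobenius systems. The twist equivalence $\Theta$ is the isomorphism on cohomology induced by $g$ followed by the isomorphism identifying the homology of the twisted system $A'_{h,t}$ with that of $A_{h,t}$; explicitly, $\Theta$ is induced by the cochain isomorphism $C^*_{\tilde h,\tilde t}(L)\to C^*_{h,t}(L)$ which on the summand indexed by $v$ equals $a^{-d(v)}g^{\otimes k_v}$, where $d(v)=\tfrac12(|v|+k_v-k_{(0,\dots,0)})$ is the number of circle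 splittings along any directed path of edges from $(0,\dots,0)$ to $v$. *)

theory Defs
  imports "HOL-Computational_Algebra.Polynomial" "HOL-Library.FuncSet"
begin

section \<open>The coefficient field\<close>

text \<open>The first disjunct says that the field is isomorphic to the rationals; a field with
  \<open>p\<close> elements, \<open>p\<close> prime, is the prime field of characteristic \<open>p\<close>.\<close>

definition is_Q_or_Fp :: "'k::field itself \<Rightarrow> bool" where
  "is_Q_or_Fp (_ :: 'k itself) \<longleftrightarrow>
     (\<exists>\<phi> :: rat \<Rightarrow> 'k. bij \<phi> \<and> \<phi> 1 = 1 \<and>
        (\<forall>x y. \<phi> (x + y) = \<phi> x + \<phi> y) \<and> (\<forall>x y. \<phi> (x * y) = \<phi> x * \<phi> y)) \<or>
     (\<exists>p. prime p \<and> card (UNIV :: 'k set) = p)"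


section \<open>Oriented link diagrams\<close>

text \<open>Planar diagram codes. The four arcs \<open>i j k l\<close> at a crossing are listed
  counterclockwise, starting with the incoming end of the under-strand. The under-strand thus
  runs from \<open>i\<close> to \<open>k\<close>; the over-strand runs from \<open>l\<close> to \<open>j\<close>
  at a positive crossing and from \<open>j\<close> to \<open>l\<close> at a negative one.\<close>

datatype crossing = Xpos nat nat nat nat | Xneg nat nat nat nat

fun corners :: "crossing \<Rightarrow> nat list" where
  "corners (Xpos i j k l) = [i, j, k, l]"
| "corners (Xneg i j k l) = [i, j, k, l]"

fun incoming :: "crossing \<Rightarrow> nat list" where
  "incoming (Xpos i j k l) = [i, l]"
| "incoming (Xneg i j k l) = [i, j]"

fun outgoing :: "crossing \<Rightarrow> nat list" where
  "outgoing (Xpos i j k l) = [k, j]"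
| "outgoing (Xneg i j k l) = [k, l]"

fun positive :: "crossing \<Rightarrow> bool" where
  "positive (Xpos i j k l) = True"
| "positive (Xneg i j k l) = False"

text \<open>The elements of \<open>loops\<close> name the components of the diagram that pass through no
  crossing. The position in the list \<open>crossings\<close> is the ordering of the crossings,
  counted from 0.\<close>

record diagram =
  crossings :: "crossing list"
  loops :: "nat set"

definition ncross :: "diagram \<Rightarrow> nat" where
  "ncross D = length (crossings D)"

definition cpos :: "diagram \<Rightarrow> nat" where
  "cpos D = length (filter positive (crossings D))"

definition cneg :: "diagram \<Rightarrow> nat" where
  "cneg D = length (filter (\<lambda>c. \<not> positive c) (crossings D))"

definition arcs :: "diagram \<Rightarrow> nat set" where
  "arcs D = loops D \<union> (\<Union>c\<in>set (crossings D). set (corners c))"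

definition pieces :: "'a set \<Rightarrow> ('a \<times> 'a) set \<Rightarrow> 'a set set" where
  "pieces A R = A // (R \<union> R\<inverse>)\<^sup>*"

text \<open>Planarity: the dart \<open>(c, s)\<close> is the end of an arc in the \<open>s\<close>-th corner of
  the \<open>c\<close>-th crossing. Going to the other end of the arc and then to the next corner
  counterclockwise walks around a face. The 4-valent graph of the diagram has \<open>m\<close> vertices
  and \<open>2 * m\<close> edges. Each of its connected components determines a closed oriented surface,
  whose Euler characteristic is at most 2, with equality for the sphere only; so all components
  are planar iff the Euler characteristics add up to twice the number of components.\<close>

definition darts :: "diagram \<Rightarrow> (nat \<times> nat) set" where
  "darts D = {..<ncross D} \<times> {..<4}"

definition dart_arc :: "diagram \<Rightarrow> nat \<times> nat \<Rightarrow> nat" where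
  "dart_arc D d = corners (crossings D ! fst d) ! snd d"

definition face_step :: "diagram \<Rightarrow> ((nat \<times> nat) \<times> (nat \<times> nat)) set" where
  "face_step D = {(d, (c, (s + 1) mod 4)) | d c s.
     d \<in> darts D \<and> (c, s) \<in> darts D \<and> d \<noteq> (c, s) \<and> dart_arc D d = dart_arc D (c, s)}"

definition crossing_adj :: "diagram \<Rightarrow> (nat \<times> nat) set" where
  "crossing_adj D = {(c, c') | c c'. \<exists>d\<in>darts D. \<exists>d'\<in>darts D.
     fst d = c \<and> fst d' = c' \<and> dart_arc D d = dart_arc D d'}"

definition planar :: "diagram \<Rightarrow> bool" where
  "planar D \<longleftrightarrow>
     int (ncross D) - 2 * int (ncross D) + int (card (pieces (darts D) (face_step D)))
       = 2 * int (card (pieces {..<ncross D} (crossing_adj D)))"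

definition oriented_link_diagram :: "diagram \<Rightarrow> bool" where
  "oriented_link_diagram D \<longleftrightarrow>
     (let ins = concat (map incoming (crossings D));
          outs = concat (map outgoing (crossings D))
      in distinct ins \<and> distinct outs \<and> set ins = set outs \<and>
         finite (loops D) \<and> loops D \<inter> set ins = {}) \<and>
     planar D"


section \<open>The cube of smoothings\<close>

text \<open>A vertex of the cube \<open>{0,1}\<^sup>m\<close> is encoded as the set of those crossings that are
  1-smoothed. With the above conventions, the smoothing joining \<open>i\<close> with \<open>j\<close> and
  \<open>k\<close> with \<open>l\<close> preserves the orientation at positive crossings, the other one at
  negative crossings.\<close>

fun smoothing :: "bool \<Rightarrow> crossing \<Rightarrow> (nat \<times> nat) set" where
  "smoothing one (Xpos i j k l) = (if one then {(i, l), (j, k)} else {(i, j), (k, l)})"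
| "smoothing one (Xneg i j k l) = (if one then {(i, l), (j, k)} else {(i, j), (k, l)})"

definition joins :: "diagram \<Rightarrow> nat set \<Rightarrow> (nat \<times> nat) set" where
  "joins D v = (\<Union>c<ncross D. smoothing (c \<in> v) (crossings D ! c))"

text \<open>A circle of the resolution \<open>D\<^sub>v\<close> is represented by the set of arcs it consists of.\<close>

definition circles :: "diagram \<Rightarrow> nat set \<Rightarrow> nat set set" where
  "circles D v = pieces (arcs D) (joins D v)"

definition circle_of :: "diagram \<Rightarrow> nat set \<Rightarrow> nat \<Rightarrow> nat set" where
  "circle_of D v e = (joins D v \<union> (joins D v)\<inverse>)\<^sup>* `` {e}"


section \<open>The Frobenius system\<close>

text \<open>The basis \<open>1, x\<close> of \<open>\<K>[x] / (x\<^sup>2 - h x - t)\<close>, whose elements are represented by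
  their remainders of degree less than 2.\<close>

datatype gen = One | X

fun gdeg :: "gen \<Rightarrow> nat" where
  "gdeg One = 0"
| "gdeg X = 1"

definition relpoly :: "'k::field \<Rightarrow> 'k \<Rightarrow> 'k poly" where
  "relpoly h t = [:- t, - h, 1:]"

text \<open>\<open>mult_coeff h t u u' w\<close> is the coefficient of \<open>w\<close> in \<open>u u'\<close>, and
  \<open>comult_coeff h t u w w'\<close> that of \<open>w \<otimes> w'\<close> in \<open>\<Delta>(u)\<close>.\<close>

definition mult_coeff :: "'k::field \<Rightarrow> 'k \<Rightarrow> gen \<Rightarrow> gen \<Rightarrow> gen \<Rightarrow> 'k" where
  "mult_coeff h t u u' w =
     coeff ((monom 1 (gdeg u) * monom 1 (gdeg u')) mod relpoly h t) (gdeg w)"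

fun comult_coeff :: "'k::field \<Rightarrow> 'k \<Rightarrow> gen \<Rightarrow> gen \<Rightarrow> gen \<Rightarrow> 'k" where
  "comult_coeff h t One One One = - h"
| "comult_coeff h t One One X = 1"
| "comult_coeff h t One X One = 1"
| "comult_coeff h t One X X = 0"
| "comult_coeff h t X One One = t"
| "comult_coeff h t X One X = 0"
| "comult_coeff h t X X One = 0"
| "comult_coeff h t X X X = 1"


section \<open>The cochain complex\<close>

text \<open>A state is a vertex \<open>v\<close> together with a labelling of the circles of \<open>D\<^sub>v\<close> by basis
  elements, i.e. a basis tensor of the tensor power of the algebra indexed by these circles. A
  cochain is given by its coefficients with respect to the basis of states.\<close>

type_synonym state = "nat set \<times> (nat set \<Rightarrow> gen)"
type_synonym 'k chain = "state \<Rightarrow> 'k"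

definition labellings :: "diagram \<Rightarrow> nat set \<Rightarrow> (nat set \<Rightarrow> gen) set" where
  "labellings D v = circles D v \<rightarrow>\<^sub>E UNIV"

definition states :: "diagram \<Rightarrow> state set" where
  "states D = {(v, f). v \<subseteq> {..<ncross D} \<and> f \<in> labellings D v}"

definition cochains :: "diagram \<Rightarrow> int \<Rightarrow> 'k::field chain set" where
  "cochains D i =
     {w. \<forall>v f. w (v, f) \<noteq> 0 \<longrightarrow> (v, f) \<in> states D \<and> int (card v) = i + int (cneg D)}"

text \<open>Matrix entry of the (unsigned) map along the edge from \<open>v\<close> to \<open>insert c v\<close>, from the
  basis tensor \<open>f\<close> to the basis tensor \<open>f'\<close>. The circles through the crossing
  \<open>c\<close> are those through its corners 0 and 2, both before and after the change of
  smoothing. For planar diagrams the last case does not occur.\<close>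

definition edge_coeff ::
  "'k::field \<Rightarrow> 'k \<Rightarrow> diagram \<Rightarrow> nat \<Rightarrow> nat set \<Rightarrow> (nat set \<Rightarrow> gen) \<Rightarrow> (nat set \<Rightarrow> gen) \<Rightarrow> 'k" where
  "edge_coeff h t D c v f f' =
     (let v' = insert c v;
          i = corners (crossings D ! c) ! 0;
          k = corners (crossings D ! c) ! 2;
          A1 = circle_of D v i; A2 = circle_of D v k;
          B1 = circle_of D v' i; B2 = circle_of D v' k
      in if \<exists>C \<in> circles D v - {A1, A2}. f C \<noteq> f' C then 0
         else if A1 \<noteq> A2 \<and> B1 = B2 then mult_coeff h t (f A1) (f A2) (f' B1)
         else if A1 = A2 \<and> B1 \<noteq> B2 then comult_coeff h t (f A1) (f' B1) (f' B2)
         else 0)"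

definition differential :: "'k::field \<Rightarrow> 'k \<Rightarrow> diagram \<Rightarrow> 'k chain \<Rightarrow> 'k chain" where
  "differential h t D w = (\<lambda>(v', f').
     if (v', f') \<in> states D
     then \<Sum>c\<in>v'. (- 1) ^ card {b \<in> v'. b < c} *
            (\<Sum>f\<in>labellings D (v' - {c}).
               edge_coeff h t D c (v' - {c}) f f' * w (v' - {c}, f))
     else 0)"

definition cocycles :: "'k::field \<Rightarrow> 'k \<Rightarrow> diagram \<Rightarrow> int \<Rightarrow> 'k chain set" where
  "cocycles h t D i = {w \<in> cochains D i. differential h t D w = (\<lambda>_. 0)}"

definition cohomologous :: "'k::field \<Rightarrow> 'k \<Rightarrow> diagram \<Rightarrow> int \<Rightarrow> ('k chain \<times> 'k chain) set" where
  "cohomologous h t D i = {(w, w'). w \<in> cocycles h t D i \<and> w' \<in> cocycles h t D i \<and>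
     (\<exists>u \<in> cochains D (i - 1). \<forall>S. w S - w' S = differential h t D u S)}"

definition cohomology :: "'k::field \<Rightarrow> 'k \<Rightarrow> diagram \<Rightarrow> int \<Rightarrow> 'k chain set set" where
  "cohomology h t D i = cocycles h t D i // cohomologous h t D i"

definition coclass :: "'k::field \<Rightarrow> 'k \<Rightarrow> diagram \<Rightarrow> int \<Rightarrow> 'k chain \<Rightarrow> 'k chain set" where
  "coclass h t D i w = cohomologous h t D i `` {w}"


section \<open>The s-grading\<close>

fun p_gen :: "gen \<Rightarrow> int" where
  "p_gen One = 1"
| "p_gen X = - 1"

definition p_state :: "diagram \<Rightarrow> state \<Rightarrow> int" where
  "p_state D = (\<lambda>(v, f). \<Sum>C\<in>circles D v. p_gen (f C))"

definition p_component :: "diagram \<Rightarrow> int \<Rightarrow> 'k::field chain \<Rightarrow> 'k chain" where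
  "p_component D n w = (\<lambda>S. if p_state D S = n then w S else 0)"

definition p_chain :: "diagram \<Rightarrow> 'k::field chain \<Rightarrow> int" where
  "p_chain D w = Min {n. p_component D n w \<noteq> (\<lambda>_. 0)}"

definition q_chain :: "diagram \<Rightarrow> int \<Rightarrow> 'k::field chain \<Rightarrow> int" where
  "q_chain D i w = p_chain D w + i + int (cpos D) - int (cneg D)"

definition s_grading :: "'k::field \<Rightarrow> 'k \<Rightarrow> diagram \<Rightarrow> int \<Rightarrow> 'k chain set \<Rightarrow> int" where
  "s_grading h t D i \<alpha> =
     Max {q_chain D i w | w. w \<in> cocycles h t D i \<and> coclass h t D i w = \<alpha>}"


section \<open>The twist equivalence\<close>

text \<open>\<open>g_coeff a b u w\<close> is the coefficient of \<open>w\<close> in \<open>g(u)\<close>, where \<open>g\<close> sends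
  1 to 1 and \<open>y\<close> to \<open>a x + b\<close>; the generator \<open>X\<close> stands for \<open>y\<close> in the source and for
  \<open>x\<close> in the target.\<close>

definition g_coeff :: "'k::field \<Rightarrow> 'k \<Rightarrow> gen \<Rightarrow> gen \<Rightarrow> 'k" where
  "g_coeff a b u w = coeff ([:b, a:] ^ gdeg u) (gdeg w)"

text \<open>The division by 2 is exact for planar diagrams.\<close>

definition nsplit :: "diagram \<Rightarrow> nat set \<Rightarrow> int" where
  "nsplit D v = (int (card v) + int (card (circles D v)) - int (card (circles D {}))) div 2"

definition twist_cochain :: "'k::field \<Rightarrow> 'k \<Rightarrow> diagram \<Rightarrow> 'k chain \<Rightarrow> 'k chain" where
  "twist_cochain a b D w = (\<lambda>(v, f').
     if (v, f') \<in> states D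
     then a powi (- nsplit D v) *
            (\<Sum>f\<in>labellings D v. (\<Prod>C\<in>circles D v. g_coeff a b (f C) (f' C)) * w (v, f))
     else 0)"

text \<open>The map from the cohomology for \<open>(h', t')\<close> to that for \<open>(h, t)\<close> induced by
  the cochain map; the union is over representatives, all giving the same class.\<close>

definition twist_equivalence ::
  "'k::field \<Rightarrow> 'k \<Rightarrow> 'k \<Rightarrow> 'k \<Rightarrow> diagram \<Rightarrow> int \<Rightarrow> 'k chain set \<Rightarrow> 'k chain set" where
  "twist_equivalence a h' h t D i \<alpha> =
     (\<Union>w\<in>\<alpha>. coclass h t D i (twist_cochain a ((h' - a * h) / 2) D w))"

end

theory Submission
  imports Defs
begin

text \<open>The matrix of the map sending \<open>1\<close> to \<open>1\<close> and \<open>y\<close> to \<open>a x + b\<close> is triangular for the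
  filtration by \<open>p\<close>, so neither the twist cochain map nor its inverse, which is the twist
  cochain map for \<open>a\<^sup>-\<^sup>1\<close>, lowers \<open>p\<close>. Hence both preserve \<open>p\<close>, and the representatives of a class and
  those of its image have the same \<open>q\<close>-degrees.\<close>

section \<open>The Frobenius system and its twist\<close>

lemma UNIV_gen: "(UNIV :: gen set) = {One, X}"
  using gen.exhaust by auto

lemma finite_gen [simp]: "finite (A :: gen set)"
  using finite_subset[OF subset_UNIV] UNIV_gen by (metis finite.emptyI finite_insert)

lemma g_coeff_simps [simp]:
  "g_coeff a b One One = 1" "g_coeff a b One X = 0"
  "g_coeff a b X One = b" "g_coeff a b X X = a"
  by (simp_all add: g_coeff_def)

text \<open>Only \<open>x * x\<close> needs reduction, with remainder \<open>t + h x\<close>; the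
  other products have degree less than 2.\<close>

lemma mult_coeff_simps [simp]:
  "mult_coeff h t One One One = 1" "mult_coeff h t One One X = 0"
  "mult_coeff h t One X One = 0" "mult_coeff h t One X X = 1"
  "mult_coeff h t X One One = 0" "mult_coeff h t X One X = 1"
  "mult_coeff h t X X One = t" "mult_coeff h t X X X = h"
proof -
  have x: "monom 1 (Suc 0) = [:0, 1 :: 'a:]"
    by (simp add: monom_Suc)
  have low: "p mod relpoly h t = p" if "degree p < 2" for p
    using that by (intro mod_poly_less) (simp add: relpoly_def)
  have "[:0, 0, 1:] = relpoly h t + [:t, h:]"
    by (simp add: relpoly_def)
  then have "[:0, 0, 1:] mod relpoly h t = [:t, h:] mod relpoly h t"
    by simp
  then have sq: "[:0, 0, 1:] mod relpoly h t = [:t, h:]"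
    by (simp add: low)
  show
    "mult_coeff h t One One One = 1" "mult_coeff h t One One X = 0"
    "mult_coeff h t One X One = 0" "mult_coeff h t One X X = 1"
    "mult_coeff h t X One One = 0" "mult_coeff h t X One X = 1"
    "mult_coeff h t X X One = t" "mult_coeff h t X X X = h"
    by (simp_all add: mult_coeff_def x low sq)
qed

text \<open>The entry from \<open>One\<close> to \<open>X\<close>, the only one that would lower
  \<open>p\<close>, is zero.\<close>

lemma p_gen_le_of_g_coeff: "g_coeff a b u w \<noteq> 0 \<Longrightarrow> p_gen u \<le> p_gen w"
  by (cases u; cases w) auto

text \<open>The last two conditions on \<open>b\<close> say that \<open>a x + b\<close> is a root of \<open>y\<^sup>2 - h' y - t'\<close>
  in \<open>\<K>[x] / (x\<^sup>2 - h x - t)\<close>.\<close>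

locale twist =
  fixes D :: diagram and h' t' h t a b :: "'k::field"
  assumes finite_loops: "finite (loops D)"
    and a_nonzero: "a \<noteq> 0"
    and linear: "2 * b = h' - a * h"
    and const: "b\<^sup>2 + a\<^sup>2 * t = h' * b + t'"
begin

lemma h'_eq: "h' = 2 * b + a * h"
  using linear by simp

lemma t'_eq: "t' = a\<^sup>2 * t - b\<^sup>2 - a * b * h"
  using const unfolding h'_eq by algebra

text \<open>The inverse map sends \<open>x\<close> to \<open>(y - b) / a\<close> and satisfies the
  same conditions, so every fact proved in the locale also holds for it.\<close>

lemma inverse_twist: "twist D h t h' t' (1 / a) (- b / a)"
  using finite_loops a_nonzero
  by unfold_locales (auto simp: h'_eq t'_eq field_simps power2_eq_square)

lemma g_coeff_inverse:
  "(\<Sum>v\<in>UNIV. g_coeff a b u v * g_coeff (1 / a) (- b / a) v w) = (if u = w then 1 else 0)"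
  using a_nonzero by (cases u; cases w) (auto simp: UNIV_gen)

text \<open>Multiplicativity is what merge edges need; the root condition enters when both factors
  are \<open>y\<close>.\<close>

lemma g_mult:
  "(\<Sum>u\<in>UNIV. \<Sum>u'\<in>UNIV. g_coeff a b p u * g_coeff a b q u' * mult_coeff h t u u' r)
     = (\<Sum>u\<in>UNIV. mult_coeff h' t' p q u * g_coeff a b u r)"
  by (cases p; cases q; cases r)
    (auto simp: UNIV_gen h'_eq t'_eq algebra_simps power2_eq_square)

text \<open>The coproduct is respected only up to twisting: the factor \<open>a\<close> is that of
  the twisted coproduct, and the powers of \<open>a\<close> in \<open>twist_cochain\<close> absorb
  it.\<close>

lemma g_comult:
  "a * (\<Sum>u\<in>UNIV. g_coeff a b p u * comult_coeff h t u r s)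
     = (\<Sum>u\<in>UNIV. \<Sum>u'\<in>UNIV. comult_coeff h' t' p u u' * (g_coeff a b u r * g_coeff a b u' s))"
  by (cases p; cases r; cases s)
    (auto simp: UNIV_gen h'_eq t'_eq algebra_simps power2_eq_square)

end

section \<open>Circles along an edge of the cube\<close>

abbreviation conn :: "('a \<times> 'a) set \<Rightarrow> ('a \<times> 'a) set" where
  "conn R \<equiv> (R \<union> R\<inverse>)\<^sup>*"

lemma sym_conn: "sym (conn R)"
  by (intro sym_rtrancl sym_Un_converse)

lemma conn_class_eq: "(x, y) \<in> conn R \<Longrightarrow> conn R `` {x} = conn R `` {y}"
  using symD[OF sym_conn[of R]] by (auto intro: rtrancl_trans)

text \<open>A path from \<open>x\<close> can use an edge of \<open>E'\<close> only at a point of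
  \<open>P\<close>, and by induction along the path no such point is reached.\<close>

lemma conn_class_subset:
  assumes "conn (R \<union> E) `` {x} \<inter> P = {}" "E' \<subseteq> P \<times> P"
  shows "conn (R \<union> E') `` {x} \<subseteq> conn (R \<union> E) `` {x}"
proof
  fix y assume "y \<in> conn (R \<union> E') `` {x}"
  then have "(x, y) \<in> conn (R \<union> E')" by simp
  then show "y \<in> conn (R \<union> E) `` {x}"
  proof (induction rule: rtrancl_induct)
    case (step y z)
    with assms have "(y, z) \<in> R \<union> R\<inverse>" by auto
    then have "(y, z) \<in> (R \<union> E) \<union> (R \<union> E)\<inverse>" by auto
    with step.IH show ?case by (auto intro: rtrancl_into_rtrancl)
  qed simp
qed

lemma conn_class_change_edges:
  assumes "conn (R \<union> E) `` {x} \<inter> P = {}" "E \<subseteq> P \<times> P" "E' \<subseteq> P \<times> P"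
  shows "conn (R \<union> E') `` {x} = conn (R \<union> E) `` {x}"
proof
  show *: "conn (R \<union> E') `` {x} \<subseteq> conn (R \<union> E) `` {x}"
    by (rule conn_class_subset[OF assms(1,3)])
  \<comment> \<open>By the inclusion just shown the new class avoids \<open>P\<close> too, so
    \<open>E\<close> and \<open>E'\<close> can be exchanged.\<close>
  show "conn (R \<union> E) `` {x} \<subseteq> conn (R \<union> E') `` {x}"
    by (rule conn_class_subset[OF _ assms(2)]) (use * assms(1) in auto)
qed

text \<open>Here \<open>P\<close> stands for the four corners of a crossing and \<open>E\<close>,
  \<open>E'\<close> for its two smoothings. A class other than those of \<open>i\<close> and
  \<open>k\<close> misses \<open>P\<close>, so changing the edges there does not affect it.\<close>

lemma pieces_change_edges:
  assumes "E \<subseteq> P \<times> P" "E' \<subseteq> P \<times> P" "i \<in> P" "k \<in> P"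
    and P: "\<And>p. p \<in> P \<Longrightarrow> (p, i) \<in> conn (R \<union> E) \<or> (p, k) \<in> conn (R \<union> E)"
  shows "pieces A (R \<union> E) - {conn (R \<union> E) `` {i}, conn (R \<union> E) `` {k}}
    \<subseteq> pieces A (R \<union> E') - {conn (R \<union> E') `` {i}, conn (R \<union> E') `` {k}}"
proof
  fix C assume C: "C \<in> pieces A (R \<union> E) - {conn (R \<union> E) `` {i}, conn (R \<union> E) `` {k}}"
  then obtain x where x: "x \<in> A" "C = conn (R \<union> E) `` {x}"
    by (auto simp: pieces_def quotient_def)
  have avoid: "C \<inter> P = {}"
  proof (rule ccontr)
    assume "C \<inter> P \<noteq> {}"
    then obtain p where p: "p \<in> P" "(x, p) \<in> conn (R \<union> E)" using x by auto
    with P have "(x, i) \<in> conn (R \<union> E) \<or> (x, k) \<in> conn (R \<union> E)"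
      by (meson rtrancl_trans)
    then have "C = conn (R \<union> E) `` {i} \<or> C = conn (R \<union> E) `` {k}"
      unfolding x(2) by (metis conn_class_eq)
    with C show False by simp
  qed
  then have "C = conn (R \<union> E') `` {x}"
    using conn_class_change_edges[of R E x P E'] assms x by auto
  then have "C \<in> pieces A (R \<union> E')"
    using x by (auto simp: pieces_def quotient_def)
  moreover have "C \<noteq> conn (R \<union> E') `` {i}" "C \<noteq> conn (R \<union> E') `` {k}"
    using avoid assms(3,4) by auto
  ultimately show "C \<in> pieces A (R \<union> E') - {conn (R \<union> E') `` {i}, conn (R \<union> E') `` {k}}"
    by simp
qed

lemma circles_along_edge:
  assumes "c < ncross D" "c \<notin> v"
    and "i = corners (crossings D ! c) ! 0" "k = corners (crossings D ! c) ! 2"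
  shows "circles D v - {circle_of D v i, circle_of D v k}
    = circles D (insert c v) - {circle_of D (insert c v) i, circle_of D (insert c v) k}"
proof -
  define j where "j = corners (crossings D ! c) ! 1"
  define l where "l = corners (crossings D ! c) ! 3"
  \<comment> \<open>The joins at the other crossings are common to both resolutions.\<close>
  define R where "R = (\<Union>c'\<in>{..<ncross D} - {c}. smoothing (c' \<in> v) (crossings D ! c'))"
  define E where "E = {(i, j), (k, l)}"
  define E' where "E' = {(i, l), (j, k)}"
  have s: "smoothing False (crossings D ! c) = E" "smoothing True (crossings D ! c) = E'"
    using assms(3,4) by (cases "crossings D ! c"; simp add: E_def E'_def j_def l_def)+
  have split: "{..<ncross D} = insert c ({..<ncross D} - {c})"
    using assms(1) by auto
  have v: "joins D v = R \<union> E"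
    unfolding joins_def by (subst split) (use assms(2) s R_def in auto)
  have "joins D (insert c v) = smoothing True (crossings D ! c) \<union>
      (\<Union>c'\<in>{..<ncross D} - {c}. smoothing (c' \<in> insert c v) (crossings D ! c'))"
    unfolding joins_def by (subst split, subst UN_insert) (simp only: insertI1)
  also have "(\<Union>c'\<in>{..<ncross D} - {c}. smoothing (c' \<in> insert c v) (crossings D ! c')) = R"
    unfolding R_def by (intro SUP_cong) auto
  finally have v': "joins D (insert c v) = R \<union> E'" using s by auto
  \<comment> \<open>Either smoothing joins each of the corners \<open>j\<close> and \<open>l\<close>
    to \<open>i\<close> or to \<open>k\<close>, so every circle through the crossing is that of
    \<open>i\<close> or of \<open>k\<close>.\<close>
  have "pieces (arcs D) (R \<union> E) - {conn (R \<union> E) `` {i}, conn (R \<union> E) `` {k}}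
      \<subseteq> pieces (arcs D) (R \<union> E') - {conn (R \<union> E') `` {i}, conn (R \<union> E') `` {k}}"
    by (rule pieces_change_edges[of E "{i, j, k, l}" E']) (auto simp: E_def E'_def)
  moreover have "pieces (arcs D) (R \<union> E') - {conn (R \<union> E') `` {i}, conn (R \<union> E') `` {k}}
      \<subseteq> pieces (arcs D) (R \<union> E) - {conn (R \<union> E) `` {i}, conn (R \<union> E) `` {k}}"
    by (rule pieces_change_edges[of E' "{i, j, k, l}" E]) (auto simp: E_def E'_def)
  ultimately show ?thesis
    unfolding circles_def circle_of_def v v' by (rule subset_antisym)
qed

section \<open>Membership and finiteness of circles, labellings and states\<close>

lemma circle_of_in_circles: "e \<in> arcs D \<Longrightarrow> circle_of D v e \<in> circles D v"
  by (auto simp: circle_of_def circles_def pieces_def quotient_def)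

lemma corner_in_arcs: "c < ncross D \<Longrightarrow> n < 4 \<Longrightarrow> corners (crossings D ! c) ! n \<in> arcs D"
proof -
  assume "c < ncross D" "n < 4"
  moreover have "length (corners x) = 4" for x by (cases x) auto
  ultimately show ?thesis
    unfolding arcs_def ncross_def by (auto intro!: UnI2 bexI[of _ "crossings D ! c"])
qed

lemma finite_circles: "finite (loops D) \<Longrightarrow> finite (circles D v)"
  by (auto simp: circles_def pieces_def quotient_def arcs_def)

lemma finite_labellings: "finite (loops D) \<Longrightarrow> finite (labellings D v)"
  by (auto simp: labellings_def intro!: finite_PiE finite_circles)

lemma finite_states: "finite (loops D) \<Longrightarrow> finite (states D)"
proof -
  assume "finite (loops D)"
  moreover have "states D = Sigma (Pow {..<ncross D}) (labellings D)"
    by (auto simp: states_def)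
  ultimately show ?thesis
    by (auto intro!: finite_SigmaI finite_labellings)
qed

section \<open>Sums over labellings prescribed on all but one or two circles\<close>

text \<open>Such a labelling is determined by its value at \<open>A\<close>. This reduces a sum over
  the labellings at one end of an edge to a sum over the label of the one circle through the
  crossing.\<close>

lemma sum_PiE_agree1:
  fixes F :: "'b \<Rightarrow> 'c::comm_monoid_add"
  assumes "A \<notin> S" "finite S" "finite (UNIV :: 'b set)"
  shows "(\<Sum>f\<in>insert A S \<rightarrow>\<^sub>E UNIV. if \<forall>C\<in>S. f C = k C then F (f A) else 0) = (\<Sum>u\<in>UNIV. F u)"
proof -
  have "(\<Sum>f\<in>insert A S \<rightarrow>\<^sub>E UNIV. if \<forall>C\<in>S. f C = k C then F (f A) else 0)
      = (\<Sum>f\<in>{f \<in> insert A S \<rightarrow>\<^sub>E UNIV. \<forall>C\<in>S. f C = k C}. F (f A))"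
    using assms by (intro sum.inter_filter[symmetric] finite_PiE) auto
  also have "\<dots> = (\<Sum>u\<in>UNIV. F u)"
    by (rule sum.reindex_bij_witness[of _ "\<lambda>u. (restrict k S)(A := u)" "\<lambda>f. f A"])
      (use assms in \<open>auto simp: fun_eq_iff PiE_iff extensional_def\<close>)
  finally show ?thesis .
qed

text \<open>The analogue for the end of an edge where two circles pass through the crossing.\<close>

lemma sum_PiE_agree2:
  fixes F :: "'b \<Rightarrow> 'b \<Rightarrow> 'c::comm_monoid_add"
  assumes "A \<noteq> B" "A \<notin> S" "B \<notin> S" "finite S" "finite (UNIV :: 'b set)"
  shows "(\<Sum>f\<in>insert A (insert B S) \<rightarrow>\<^sub>E UNIV. if \<forall>C\<in>S. f C = k C then F (f A) (f B) else 0)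
    = (\<Sum>u\<in>UNIV. \<Sum>u'\<in>UNIV. F u u')"
proof -
  have "(\<Sum>f\<in>insert A (insert B S) \<rightarrow>\<^sub>E UNIV. if \<forall>C\<in>S. f C = k C then F (f A) (f B) else 0)
      = (\<Sum>f\<in>{f \<in> insert A (insert B S) \<rightarrow>\<^sub>E UNIV. \<forall>C\<in>S. f C = k C}. F (f A) (f B))"
    using assms by (intro sum.inter_filter[symmetric] finite_PiE) auto
  also have "\<dots> = (\<Sum>(u, u')\<in>UNIV \<times> UNIV. F u u')"
    by (rule sum.reindex_bij_witness[of _ "\<lambda>(u, u'). (restrict k S)(A := u, B := u')"
          "\<lambda>f. (f A, f B)"])
      (use assms in \<open>auto simp: fun_eq_iff PiE_iff extensional_def\<close>)
  also have "\<dots> = (\<Sum>u\<in>UNIV. \<Sum>u'\<in>UNIV. F u u')"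
    by (simp add: sum.cartesian_product)
  finally show ?thesis .
qed

section \<open>The twist is a cochain map\<close>

context twist
begin

text \<open>Circles away from the crossing contribute the same factor to both composites; what
  remains is \<open>g_mult\<close> for a merge and \<open>g_comult\<close> for a split, whose factor
  \<open>a\<close> matches the change of \<open>nsplit\<close>.\<close>

lemma edge_twist:
  assumes c: "c < ncross D" "c \<notin> v" "finite v"
  shows "a powi (- nsplit D v) * (\<Sum>f'\<in>labellings D v.
        (\<Prod>C\<in>circles D v. g_coeff a b (f C) (f' C)) * edge_coeff h t D c v f' f'')
    = a powi (- nsplit D (insert c v)) * (\<Sum>f'\<in>labellings D (insert c v).
        edge_coeff h' t' D c v f f' *
        (\<Prod>C\<in>circles D (insert c v). g_coeff a b (f' C) (f'' C)))"
    (is "_ * ?L = _ * ?R")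
proof -
  define i where "i = corners (crossings D ! c) ! 0"
  define k where "k = corners (crossings D ! c) ! 2"
  define A1 where "A1 = circle_of D v i"
  define A2 where "A2 = circle_of D v k"
  define B1 where "B1 = circle_of D (insert c v) i"
  define B2 where "B2 = circle_of D (insert c v) k"
  define S where "S = circles D v - {A1, A2}"
  \<comment> \<open>On \<open>S\<close> the edge map is the identity: it forces
    \<open>f' = f''\<close> in \<open>?L\<close> and \<open>f' = f\<close> in \<open>?R\<close>, so
    this product factors out of both.\<close>
  define G where "G = (\<Prod>C\<in>S. g_coeff a b (f C) (f'' C))"
  have S': "S = circles D (insert c v) - {B1, B2}"
    unfolding S_def A1_def A2_def B1_def B2_def
    by (rule circles_along_edge[OF c(1,2) i_def k_def])
  have arcs: "i \<in> arcs D" "k \<in> arcs D"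
    using corner_in_arcs[OF c(1)] by (auto simp: i_def k_def)
  have AB: "A1 \<in> circles D v" "A2 \<in> circles D v"
    "B1 \<in> circles D (insert c v)" "B2 \<in> circles D (insert c v)"
    unfolding A1_def A2_def B1_def B2_def using arcs by (auto intro: circle_of_in_circles)
  have cv: "circles D v = insert A1 (insert A2 S)"
    "circles D (insert c v) = insert B1 (insert B2 S)"
    using AB S' unfolding S_def by auto
  have notin: "A1 \<notin> S" "A2 \<notin> S" "B1 \<notin> S" "B2 \<notin> S"
    using S' unfolding S_def by auto
  have fin: "finite S" unfolding S_def using finite_circles[OF finite_loops] by auto
  have edge: "edge_coeff x y D c v p q =
    (if \<forall>C\<in>S. p C = q C then
       if A1 \<noteq> A2 \<and> B1 = B2 then mult_coeff x y (p A1) (p A2) (q B1)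
       else if A1 = A2 \<and> B1 \<noteq> B2 then comult_coeff x y (p A1) (q B1) (q B2)
       else 0 else 0)" for x y :: 'k and p q
    unfolding edge_coeff_def Let_def A1_def A2_def B1_def B2_def i_def k_def S_def by auto
  consider "A1 \<noteq> A2" "B1 = B2" | "A1 = A2" "B1 \<noteq> B2" | "A1 \<noteq> A2 \<longleftrightarrow> B1 \<noteq> B2" by auto
  then show ?thesis
  proof cases
    case 1
    have "?L = (\<Sum>f'\<in>labellings D v. if \<forall>C\<in>S. f' C = f'' C
        then G * (g_coeff a b (f A1) (f' A1) * g_coeff a b (f A2) (f' A2)
               * mult_coeff h t (f' A1) (f' A2) (f'' B1)) else 0)"
      using 1 notin fin unfolding edge cv G_def
      by (intro sum.cong refl) (auto simp: mult_ac)
    also have "\<dots> = G * (\<Sum>u\<in>UNIV. \<Sum>u'\<in>UNIV.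
        g_coeff a b (f A1) u * g_coeff a b (f A2) u' * mult_coeff h t u u' (f'' B1))"
      unfolding labellings_def cv using 1 notin fin
      by (subst sum_PiE_agree2) (auto simp: sum_distrib_left)
    also have "\<dots> = G * (\<Sum>u\<in>UNIV. mult_coeff h' t' (f A1) (f A2) u * g_coeff a b u (f'' B1))"
      by (simp only: g_mult)
    also have "\<dots> = (\<Sum>f'\<in>labellings D (insert c v). if \<forall>C\<in>S. f' C = f C
        then G * (mult_coeff h' t' (f A1) (f A2) (f' B1) * g_coeff a b (f' B1) (f'' B1)) else 0)"
      unfolding labellings_def cv \<open>B1 = B2\<close> insert_absorb2 using 1 notin fin
      by (subst sum_PiE_agree1) (auto simp: sum_distrib_left)
    also have "\<dots> = ?R"
      using 1 notin fin unfolding edge cv G_def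
      by (intro sum.cong refl) (auto simp: mult_ac)
    finally have "?L = ?R" .
    \<comment> \<open>A merge adds 1 to \<open>card v\<close> and removes one circle, so the number
      of splittings stays the same.\<close>
    moreover have "card (circles D v) = card (circles D (insert c v)) + 1"
      unfolding cv using 1 notin fin by simp
    then have "nsplit D (insert c v) = nsplit D v"
      unfolding nsplit_def using c by simp
    ultimately show ?thesis by simp
  next
    case 2
    have "a * ?L = a * (\<Sum>f'\<in>labellings D v. if \<forall>C\<in>S. f' C = f'' C
        then G * (g_coeff a b (f A1) (f' A1) * comult_coeff h t (f' A1) (f'' B1) (f'' B2)) else 0)"
      using 2 notin fin unfolding edge cv G_def
      by (intro arg_cong[of _ _ "\<lambda>x. a * x"] sum.cong refl) (auto simp: mult_ac)
    also have "\<dots> = G * (a * (\<Sum>u\<in>UNIV.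
        g_coeff a b (f A1) u * comult_coeff h t u (f'' B1) (f'' B2)))"
      unfolding labellings_def cv \<open>A1 = A2\<close> insert_absorb2 using 2 notin fin
      by (subst sum_PiE_agree1) (auto simp: sum_distrib_left mult_ac)
    also have "\<dots> = G * (\<Sum>u\<in>UNIV. \<Sum>u'\<in>UNIV. comult_coeff h' t' (f A1) u u' *
        (g_coeff a b u (f'' B1) * g_coeff a b u' (f'' B2)))"
      by (simp only: g_comult)
    also have "\<dots> = (\<Sum>f'\<in>labellings D (insert c v). if \<forall>C\<in>S. f' C = f C
        then G * (comult_coeff h' t' (f A1) (f' B1) (f' B2) *
          (g_coeff a b (f' B1) (f'' B1) * g_coeff a b (f' B2) (f'' B2))) else 0)"
      unfolding labellings_def cv using 2 notin fin
      by (subst sum_PiE_agree2) (auto simp: sum_distrib_left)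
    also have "\<dots> = ?R"
      using 2 notin fin unfolding edge cv G_def
      by (intro sum.cong refl) (auto simp: mult_ac)
    finally have LR: "a * ?L = ?R" .
    \<comment> \<open>A split raises \<open>card v\<close> and the number of circles by 1 each, so
      the numerator in \<open>nsplit\<close> grows by 2 and the rounded quotient by exactly
      1.\<close>
    have "card (circles D (insert c v)) = card (circles D v) + 1"
      unfolding cv using 2 notin fin by simp
    then have "nsplit D (insert c v) = nsplit D v + 1"
      unfolding nsplit_def using c by simp
    then have "a powi (- nsplit D v) = a powi (- nsplit D (insert c v)) * a"
      using a_nonzero power_int_add_1[of a "- nsplit D (insert c v)"] by simp
    with LR show ?thesis by (simp add: mult.assoc)
  next
    \<comment> \<open>A crossing met by equally many circles before and after gives the default
      value 0 of \<open>edge_coeff\<close>, for both systems.\<close>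
    case 3
    then have "edge_coeff x y D c v p q = 0" for x y :: 'k and p q
      unfolding edge by auto
    then show ?thesis by simp
  qed
qed

text \<open>Both sides are sums over an edge into the vertex, a labelling of its source and an
  intermediate labelling; after exchanging sums, \<open>edge_twist\<close> compares them edge by
  edge.\<close>

lemma twist_differential:
  fixes w :: "'k chain"
  shows "twist_cochain a b D (differential h' t' D w) = differential h t D (twist_cochain a b D w)"
proof
  fix S :: state
  obtain v f'' where S: "S = (v, f'')" by fastforce
  show "twist_cochain a b D (differential h' t' D w) S
    = differential h t D (twist_cochain a b D w) S"
  proof (cases "S \<in> states D")
    case False
    then show ?thesis by (simp add: S twist_cochain_def differential_def)
  next
    case True
    then have v: "v \<subseteq> {..<ncross D}" and f'': "f'' \<in> labellings D v"
      by (auto simp: S states_def)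
    have "finite v" using v by (rule finite_subset) simp
    \<comment> \<open>The sign depends only on the target vertex and the edge, so it is common to
      both composites.\<close>
    define sg where "sg c = (- 1 :: 'k) ^ card {b \<in> v. b < c}" for c
    have st: "(v, f') \<in> states D" if "f' \<in> labellings D v" for f'
      using that v by (simp add: states_def)
    have st': "(v - {c}, f') \<in> states D" if "f' \<in> labellings D (v - {c})" for f' c
      using that v by (auto simp: states_def)
    have "twist_cochain a b D (differential h' t' D w) S = a powi (- nsplit D v) *
      (\<Sum>f'\<in>labellings D v. (\<Prod>C\<in>circles D v. g_coeff a b (f' C) (f'' C)) *
        (\<Sum>c\<in>v. sg c * (\<Sum>f\<in>labellings D (v - {c}).
           edge_coeff h' t' D c (v - {c}) f f' * w (v - {c}, f))))"
      using True st by (simp add: S twist_cochain_def differential_def sg_def)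
    also have "\<dots> = (\<Sum>f'\<in>labellings D v. \<Sum>c\<in>v. \<Sum>f\<in>labellings D (v - {c}).
        sg c * w (v - {c}, f) * (a powi (- nsplit D v) *
          (edge_coeff h' t' D c (v - {c}) f f' *
            (\<Prod>C\<in>circles D v. g_coeff a b (f' C) (f'' C)))))"
      by (simp add: sum_distrib_left mult_ac)
    also have "\<dots> = (\<Sum>c\<in>v. \<Sum>f\<in>labellings D (v - {c}). \<Sum>f'\<in>labellings D v.
        sg c * w (v - {c}, f) * (a powi (- nsplit D v) *
          (edge_coeff h' t' D c (v - {c}) f f' *
            (\<Prod>C\<in>circles D v. g_coeff a b (f' C) (f'' C)))))"
      by (subst sum.swap) (intro sum.cong refl sum.swap)
    also have "\<dots> = (\<Sum>c\<in>v. \<Sum>f\<in>labellings D (v - {c}).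
        sg c * w (v - {c}, f) * (a powi (- nsplit D v) * (\<Sum>f'\<in>labellings D v.
          edge_coeff h' t' D c (v - {c}) f f' *
            (\<Prod>C\<in>circles D v. g_coeff a b (f' C) (f'' C)))))"
      by (simp add: sum_distrib_left)
    also have "\<dots> = (\<Sum>c\<in>v. \<Sum>f\<in>labellings D (v - {c}).
        sg c * w (v - {c}, f) * (a powi (- nsplit D (v - {c})) * (\<Sum>f'\<in>labellings D (v - {c}).
          (\<Prod>C\<in>circles D (v - {c}). g_coeff a b (f C) (f' C)) *
            edge_coeff h t D c (v - {c}) f' f'')))"
    proof (intro sum.cong refl arg_cong[of _ _ "\<lambda>x. _ * x"])
      fix c f assume "c \<in> v"
      then have "insert c (v - {c}) = v" "c < ncross D" using v by auto
      with edge_twist[of c "v - {c}" f f''] \<open>finite v\<close>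
      show "a powi (- nsplit D v) * (\<Sum>f'\<in>labellings D v.
          edge_coeff h' t' D c (v - {c}) f f' *
            (\<Prod>C\<in>circles D v. g_coeff a b (f' C) (f'' C))) =
        a powi (- nsplit D (v - {c})) * (\<Sum>f'\<in>labellings D (v - {c}).
          (\<Prod>C\<in>circles D (v - {c}). g_coeff a b (f C) (f' C)) *
            edge_coeff h t D c (v - {c}) f' f'')"
        by simp
    qed
    also have "\<dots> = (\<Sum>c\<in>v. \<Sum>f\<in>labellings D (v - {c}). \<Sum>f'\<in>labellings D (v - {c}).
        sg c * (edge_coeff h t D c (v - {c}) f' f'' * (a powi (- nsplit D (v - {c})) *
          ((\<Prod>C\<in>circles D (v - {c}). g_coeff a b (f C) (f' C)) * w (v - {c}, f)))))"
      by (simp add: sum_distrib_left mult_ac)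
    also have "\<dots> = (\<Sum>c\<in>v. \<Sum>f'\<in>labellings D (v - {c}). \<Sum>f\<in>labellings D (v - {c}).
        sg c * (edge_coeff h t D c (v - {c}) f' f'' * (a powi (- nsplit D (v - {c})) *
          ((\<Prod>C\<in>circles D (v - {c}). g_coeff a b (f C) (f' C)) * w (v - {c}, f)))))"
      by (intro sum.cong refl sum.swap)
    also have "\<dots> = (\<Sum>c\<in>v. sg c * (\<Sum>f'\<in>labellings D (v - {c}).
        edge_coeff h t D c (v - {c}) f' f'' * (a powi (- nsplit D (v - {c})) *
          (\<Sum>f\<in>labellings D (v - {c}).
            (\<Prod>C\<in>circles D (v - {c}). g_coeff a b (f C) (f' C)) * w (v - {c}, f)))))"
      by (simp add: sum_distrib_left)
    also have "\<dots> = differential h t D (twist_cochain a b D w) S"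
      using True st' by (simp add: S twist_cochain_def differential_def sg_def)
    finally show ?thesis .
  qed
qed

section \<open>Invertibility on cochains\<close>

text \<open>At each vertex the two matrices are tensor powers of mutually inverse matrices, scaled
  by inverse powers of \<open>a\<close>. Off the states both sides vanish, because \<open>w\<close>
  is a cochain.\<close>

lemma twist_twist_inverse:
  fixes w :: "'k chain"
  assumes "w \<in> cochains D i"
  shows "twist_cochain (1 / a) (- b / a) D (twist_cochain a b D w) = w"
proof
  fix S :: state
  obtain v f'' where S: "S = (v, f'')" by fastforce
  show "twist_cochain (1 / a) (- b / a) D (twist_cochain a b D w) S = w S"
  proof (cases "S \<in> states D")
    case False
    then show ?thesis using assms by (auto simp: S twist_cochain_def cochains_def)
  next
    case True
    then have v: "v \<subseteq> {..<ncross D}" and f'': "f'' \<in> labellings D v"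
      by (auto simp: S states_def)
    have st: "(v, f') \<in> states D" if "f' \<in> labellings D v" for f'
      using that v by (simp add: states_def)
    let ?g = "g_coeff a b" and ?g' = "g_coeff (1 / a) (- b / a)"
    have powers: "(1 / a) powi (- nsplit D v) * a powi (- nsplit D v) = 1"
      using a_nonzero by (simp flip: power_int_mult_distrib)
    have delta: "(\<Sum>f'\<in>labellings D v. (\<Prod>C\<in>circles D v. ?g' (f' C) (f'' C)) *
        (\<Prod>C\<in>circles D v. ?g (f C) (f' C))) = (if f = f'' then 1 else 0)"
      if f: "f \<in> labellings D v" for f
    proof -
      have "(\<Sum>f'\<in>labellings D v. (\<Prod>C\<in>circles D v. ?g' (f' C) (f'' C)) *
          (\<Prod>C\<in>circles D v. ?g (f C) (f' C)))
        = (\<Sum>f'\<in>labellings D v. \<Prod>C\<in>circles D v. ?g (f C) (f' C) * ?g' (f' C) (f'' C))"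
        by (simp add: prod.distrib mult.commute)
      \<comment> \<open>Distributivity: choosing a labelling means choosing a label for each circle
        independently.\<close>
      also have "\<dots> = (\<Prod>C\<in>circles D v. \<Sum>u\<in>UNIV. ?g (f C) u * ?g' u (f'' C))"
        unfolding labellings_def using finite_circles[OF finite_loops]
        by (subst prod_sum_PiE) auto
      also have "\<dots> = (\<Prod>C\<in>circles D v. if f C = f'' C then 1 else 0)"
        by (simp only: g_coeff_inverse)
      also have "\<dots> = (if \<forall>C\<in>circles D v. f C = f'' C then 1 else 0)"
        using finite_circles[OF finite_loops] by (auto intro!: prod.neutral prod_zero)
      \<comment> \<open>Labellings take a fixed value off the circles.\<close>
      also have "(\<forall>C\<in>circles D v. f C = f'' C) \<longleftrightarrow> f = f''"
        using f f'' unfolding labellings_def by (metis PiE_ext)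
      finally show ?thesis .
    qed
    have "twist_cochain (1 / a) (- b / a) D (twist_cochain a b D w) S
      = (1 / a) powi (- nsplit D v) * (\<Sum>f'\<in>labellings D v.
        (\<Prod>C\<in>circles D v. ?g' (f' C) (f'' C)) * (a powi (- nsplit D v) *
          (\<Sum>f\<in>labellings D v. (\<Prod>C\<in>circles D v. ?g (f C) (f' C)) * w (v, f))))"
      using True st by (simp add: S twist_cochain_def)
    also have "\<dots> = (\<Sum>f'\<in>labellings D v. \<Sum>f\<in>labellings D v.
        ((1 / a) powi (- nsplit D v) * a powi (- nsplit D v)) *
          (w (v, f) * ((\<Prod>C\<in>circles D v. ?g' (f' C) (f'' C)) *
            (\<Prod>C\<in>circles D v. ?g (f C) (f' C)))))"
      by (simp only: sum_distrib_left mult_ac)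
    also have "\<dots> = (\<Sum>f\<in>labellings D v. \<Sum>f'\<in>labellings D v.
          w (v, f) * ((\<Prod>C\<in>circles D v. ?g' (f' C) (f'' C)) *
            (\<Prod>C\<in>circles D v. ?g (f C) (f' C))))"
      unfolding powers by (subst sum.swap) simp
    also have "\<dots> = (\<Sum>f\<in>labellings D v. w (v, f) * (if f = f'' then 1 else 0))"
      using delta by (simp flip: sum_distrib_left)
    also have "\<dots> = w S"
      using f'' finite_labellings[OF finite_loops] by (simp add: S if_distrib cong: if_cong)
    finally show ?thesis .
  qed
qed

end

lemma twist_cochains:
  "w \<in> cochains D i \<Longrightarrow> twist_cochain a b D w \<in> cochains D i"
  by (fastforce simp: cochains_def twist_cochain_def split: if_splits
      elim: sum.not_neutral_contains_not_neutral)

lemma twist_zero: "twist_cochain a b D (\<lambda>_. 0) = (\<lambda>_. 0)"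
  by (auto simp: twist_cochain_def)

lemma twist_diff:
  "twist_cochain a b D (\<lambda>S. w S - w' S) = (\<lambda>S. twist_cochain a b D w S - twist_cochain a b D w' S)"
  by (auto simp: twist_cochain_def algebra_simps sum_subtractf)

section \<open>The grading of a twisted cochain\<close>

text \<open>A homogeneous component is nonzero iff some state of its degree lies in the
  support.\<close>

lemma p_chain_eq_Min_image: "p_chain D w = Min (p_state D ` {S. w S \<noteq> 0})"
  unfolding p_chain_def p_component_def
  by (rule arg_cong[of _ _ Min]) (auto simp: fun_eq_iff)

text \<open>A state in the support of the image receives a contribution from a state of
  \<open>w\<close> at the same vertex with all label entries nonzero, so
  \<open>p_gen_le_of_g_coeff\<close> applies circle by circle. The image is assumed nonzero so that
  its minimum ranges over a nonempty set.\<close>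

lemma p_chain_twist_ge:
  fixes w :: "'k::field chain"
  assumes "finite (loops D)" "w \<in> cochains D i" "twist_cochain a b D w \<noteq> (\<lambda>_. 0)"
  shows "p_chain D w \<le> p_chain D (twist_cochain a b D w)"
proof -
  have supp: "finite {S. u S \<noteq> 0}" if "u \<in> cochains D i" for u :: "'k chain"
    using finite_subset[OF _ finite_states[OF assms(1)], of "{S. u S \<noteq> 0}"] that
    by (fastforce simp: cochains_def)
  have "p_chain D w \<le> p_state D S" if S: "twist_cochain a b D w S \<noteq> 0" for S
  proof -
    obtain v f' where S': "S = (v, f')" by fastforce
    with S have "(\<Sum>f\<in>labellings D v. (\<Prod>C\<in>circles D v. g_coeff a b (f C) (f' C)) * w (v, f)) \<noteq> 0"
      by (auto simp: twist_cochain_def split: if_splits)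
    then obtain f where f: "(\<Prod>C\<in>circles D v. g_coeff a b (f C) (f' C)) * w (v, f) \<noteq> 0"
      by (metis (no_types, lifting) sum.not_neutral_contains_not_neutral)
    then have "g_coeff a b (f C) (f' C) \<noteq> 0" if "C \<in> circles D v" for C
      using that finite_circles[OF assms(1)] by auto
    then have "p_state D (v, f) \<le> p_state D S"
      unfolding p_state_def S' by (auto intro!: sum_mono dest: p_gen_le_of_g_coeff)
    moreover have "p_chain D w \<le> p_state D (v, f)"
      unfolding p_chain_eq_Min_image using f supp[OF assms(2)] by (intro Min_le) auto
    ultimately show ?thesis by simp
  qed
  then show ?thesis
    unfolding p_chain_eq_Min_image[of D "twist_cochain a b D w"]
    using supp[OF twist_cochains[OF assms(2), of a b]] assms(3)
    by (subst Min_ge_iff) (auto simp: fun_eq_iff)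
qed

text \<open>The inequalities for the twist and for its inverse combine to an equality; the zero
  chain is its own image.\<close>

lemma (in twist) p_chain_twist:
  fixes w :: "'k chain"
  assumes "w \<in> cochains D i"
  shows "p_chain D (twist_cochain a b D w) = p_chain D w"
proof (cases "w = (\<lambda>_. 0)")
  case False
  let ?Tw = "twist_cochain a b D w"
  have inv: "twist_cochain (1 / a) (- b / a) D ?Tw = w"
    by (rule twist_twist_inverse[OF assms])
  with False have "?Tw \<noteq> (\<lambda>_. 0)" using twist_zero by metis
  then show ?thesis
    using p_chain_twist_ge[OF finite_loops assms, of a b]
      p_chain_twist_ge[OF finite_loops twist_cochains[OF assms, of a b], of "1 / a" "- b / a"]
      inv False by simp
qed (simp add: twist_zero)

section \<open>Cohomology classes\<close>

lemma differential_zero: "differential h t D (\<lambda>_. 0) = (\<lambda>_. 0)"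
  by (auto simp: differential_def)

lemma differential_uminus:
  "differential h t D (\<lambda>S. - w S) = (\<lambda>S. - differential h t D w S)"
  by (auto simp: differential_def sum_negf)

lemma differential_add:
  "differential h t D (\<lambda>S. w S + w' S) = (\<lambda>S. differential h t D w S + differential h t D w' S)"
  by (auto simp: differential_def algebra_simps sum.distrib)

text \<open>This lets equality of classes be traded for the relation between
  representatives.\<close>

lemma equiv_cohomologous: "equiv (cocycles h t D i) (cohomologous h t D i)"
proof (rule equivI)
  show "cohomologous h t D i \<subseteq> cocycles h t D i \<times> cocycles h t D i"
    by (auto simp: cohomologous_def)
  show "refl_on (cocycles h t D i) (cohomologous h t D i)"
    by (auto simp: refl_on_def cohomologous_def differential_zero cochains_def
        intro!: bexI[of _ "\<lambda>_. 0"])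
  show "sym (cohomologous h t D i)"
  proof (rule symI)
    fix w w' assume "(w, w') \<in> cohomologous h t D i"
    then obtain u where w: "w \<in> cocycles h t D i" "w' \<in> cocycles h t D i"
      and u: "u \<in> cochains D (i - 1)" "\<And>S. w S - w' S = differential h t D u S"
      by (auto simp: cohomologous_def)
    have "(\<lambda>S. - u S) \<in> cochains D (i - 1)" using u(1) by (auto simp: cochains_def)
    moreover have "w' S - w S = differential h t D (\<lambda>S. - u S) S" for S
      using u(2)[of S] unfolding differential_uminus by (metis minus_diff_eq)
    ultimately show "(w', w) \<in> cohomologous h t D i"
      using w unfolding cohomologous_def by blast
  qed
  show "trans (cohomologous h t D i)"
  proof (rule transI)
    fix w w' w'' assume "(w, w') \<in> cohomologous h t D i" "(w', w'') \<in> cohomologous h t D i"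
    then obtain u u' where w: "w \<in> cocycles h t D i" "w'' \<in> cocycles h t D i"
      and u: "u \<in> cochains D (i - 1)" "\<And>S. w S - w' S = differential h t D u S"
      and u': "u' \<in> cochains D (i - 1)" "\<And>S. w' S - w'' S = differential h t D u' S"
      by (auto simp: cohomologous_def)
    have "(\<lambda>S. u S + u' S) \<in> cochains D (i - 1)"
      using u(1) u'(1) unfolding cochains_def mem_Collect_eq by (metis add_0)
    moreover have "w S - w'' S = differential h t D (\<lambda>S. u S + u' S) S" for S
      unfolding differential_add u(2)[symmetric] u'(2)[symmetric] by simp
    ultimately show "(w, w'') \<in> cohomologous h t D i"
      using w unfolding cohomologous_def by blast
  qed
qed

section \<open>The twist on cohomology classes\<close>

context twist
begin

lemma twist_cocycles:
  "w \<in> cocycles h' t' D i \<Longrightarrow> twist_cochain a b D w \<in> cocycles h t D i"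
  by (auto simp: cocycles_def twist_cochains twist_zero simp flip: twist_differential)

lemma twist_cohomologous:
  assumes "(w, w') \<in> cohomologous h' t' D i"
  shows "(twist_cochain a b D w, twist_cochain a b D w') \<in> cohomologous h t D i"
proof -
  obtain u where w: "w \<in> cocycles h' t' D i" "w' \<in> cocycles h' t' D i"
    and u: "u \<in> cochains D (i - 1)" "\<And>S. w S - w' S = differential h' t' D u S"
    using assms by (auto simp: cohomologous_def)
  have "(\<lambda>S. w S - w' S) = differential h' t' D u"
    using u(2) by (simp add: fun_eq_iff)
  then have "(\<lambda>S. twist_cochain a b D w S - twist_cochain a b D w' S)
      = differential h t D (twist_cochain a b D u)"
    by (simp flip: twist_differential twist_diff)
  then have "\<forall>S. twist_cochain a b D w S - twist_cochain a b D w' S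
      = differential h t D (twist_cochain a b D u) S"
    by (simp add: fun_eq_iff)
  then show ?thesis
    using twist_cocycles[OF w(1)] twist_cocycles[OF w(2)] twist_cochains[OF u(1), of a b]
    unfolding cohomologous_def by blast
qed

lemma q_chain_twist:
  fixes w :: "'k chain"
  assumes "w \<in> cocycles h' t' D i"
  shows "q_chain D i (twist_cochain a b D w) = q_chain D i w"
  using assms p_chain_twist[of w i] by (simp add: q_chain_def cocycles_def)

text \<open>Cohomologous representatives have cohomologous images, so the union in
  \<open>twist_equivalence\<close> repeats a single class, and it is not empty because
  \<open>w\<close> represents its own class.\<close>

lemma twist_image_coclass:
  assumes w: "w \<in> cocycles h' t' D i"
  shows "(\<Union>w'\<in>coclass h' t' D i w. coclass h t D i (twist_cochain a b D w'))
    = coclass h t D i (twist_cochain a b D w)"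
proof -
  have "coclass h t D i (twist_cochain a b D w') = coclass h t D i (twist_cochain a b D w)"
    if "w' \<in> coclass h' t' D i w" for w'
    using equiv_class_eq[OF equiv_cohomologous twist_cohomologous, of w w' i] that
    by (simp add: coclass_def)
  moreover have "w \<in> coclass h' t' D i w"
    using equiv_class_self[OF equiv_cohomologous w] by (simp add: coclass_def)
  ultimately show ?thesis by blast
qed

text \<open>The two maxima are taken over the same set: the twist carries representatives of the
  class to representatives of its image with equal \<open>q\<close>, and the inverse twist carries
  them back.\<close>

lemma s_grading_twist:
  assumes w0: "w0 \<in> cocycles h' t' D i"
  shows "s_grading h' t' D i (coclass h' t' D i w0)
    = s_grading h t D i (coclass h t D i (twist_cochain a b D w0))"
proof -
  interpret inv: twist D h t h' t' "1 / a" "- b / a" by (rule inverse_twist)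
  note class_iff = eq_equiv_class_iff[OF equiv_cohomologous, folded coclass_def]
  have "{q_chain D i w | w. w \<in> cocycles h' t' D i \<and> coclass h' t' D i w = coclass h' t' D i w0}
    = {q_chain D i w | w. w \<in> cocycles h t D i \<and>
         coclass h t D i w = coclass h t D i (twist_cochain a b D w0)}" (is "?A = ?B")
  proof
    show "?A \<subseteq> ?B"
    proof safe
      fix w assume w: "w \<in> cocycles h' t' D i" "coclass h' t' D i w = coclass h' t' D i w0"
      then have "(w, w0) \<in> cohomologous h' t' D i" using class_iff w0 by blast
      then show "\<exists>w'. q_chain D i w = q_chain D i w' \<and> w' \<in> cocycles h t D i \<and>
          coclass h t D i w' = coclass h t D i (twist_cochain a b D w0)"
        using class_iff twist_cohomologous twist_cocycles[OF w(1)] twist_cocycles[OF w0]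
          q_chain_twist[OF w(1)] by metis
    qed
    show "?B \<subseteq> ?A"
    proof safe
      fix w assume w: "w \<in> cocycles h t D i"
        "coclass h t D i w = coclass h t D i (twist_cochain a b D w0)"
      let ?T' = "twist_cochain (1 / a) (- b / a) D"
      have "(w, twist_cochain a b D w0) \<in> cohomologous h t D i"
        using class_iff w twist_cocycles[OF w0] by blast
      then have "(?T' w, ?T' (twist_cochain a b D w0)) \<in> cohomologous h' t' D i"
        by (rule inv.twist_cohomologous)
      \<comment> \<open>Hence \<open>?T' w\<close> represents the class of \<open>w0\<close>
        itself.\<close>
      moreover have "?T' (twist_cochain a b D w0) = w0"
        using twist_twist_inverse w0 by (auto simp: cocycles_def)
      ultimately show "\<exists>w'. q_chain D i w = q_chain D i w' \<and> w' \<in> cocycles h' t' D i \<and>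
          coclass h' t' D i w' = coclass h' t' D i w0"
        using class_iff inv.twist_cocycles[OF w(1)] inv.q_chain_twist[OF w(1)] w0 by metis
    qed
  qed
  then show ?thesis unfolding s_grading_def by simp
qed

end

section \<open>From the discriminants to the conditions on \<open>b\<close>\<close>

lemma two_nonzero_of_CHAR: "CHAR('k::field) \<noteq> 2 \<Longrightarrow> (2 :: 'k) \<noteq> 0"
proof
  assume "CHAR('k) \<noteq> 2" "(2 :: 'k) = 0"
  then have "CHAR('k) dvd 2"
    using of_nat_eq_0_iff_char_dvd[where 'a = 'k, of 2] by simp
  with \<open>CHAR('k) \<noteq> 2\<close> have "CHAR('k) = 1"
    using two_is_prime_nat by (auto simp: prime_nat_iff)
  then show False
    using of_nat_CHAR[where 'a = 'k] by simp
qed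

theorem proposition3p1:
  fixes h t h' t' a :: "'k::field"
    and D :: diagram and i :: int and \<alpha> :: "'k chain set"
  assumes "is_Q_or_Fp TYPE('k)"
    and "CHAR('k) \<noteq> 2"
    and "h\<^sup>2 + 4 * t \<noteq> 0"
    and "a \<noteq> 0"
    and "(h'\<^sup>2 + 4 * t') / (h\<^sup>2 + 4 * t) = a\<^sup>2"
    and "oriented_link_diagram D"
    and "\<alpha> \<in> cohomology h' t' D i"
    and "\<alpha> \<noteq> coclass h' t' D i (\<lambda>_. 0)"
  shows "s_grading h' t' D i \<alpha> = s_grading h t D i (twist_equivalence a h' h t D i \<alpha>)"
proof -
  \<comment> \<open>With this \<open>b\<close> the map takes \<open>y - h' / 2\<close> to
    \<open>a * (x - h / 2)\<close>, so it completes both squares and compares the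
    discriminants.\<close>
  define b where "b = (h' - a * h) / 2"
  have two: "(2 :: 'k) \<noteq> 0" using assms(2) by (rule two_nonzero_of_CHAR)
  then have four: "(4 :: 'k) \<noteq> 0"
    using no_zero_divisors[OF two two] by simp
  have lin: "2 * b = h' - a * h" using two by (simp add: b_def)
  have disc: "h'\<^sup>2 + 4 * t' = a\<^sup>2 * (h\<^sup>2 + 4 * t)"
    using assms(3,5) by (simp add: field_simps)
  \<comment> \<open>The relation between the discriminants is four times the root condition; the
    factor is cancelled since the characteristic is not 2.\<close>
  have "4 * (b\<^sup>2 + a\<^sup>2 * t) = 4 * (h' * b + t')"
    using disc lin by algebra
  then have "b\<^sup>2 + a\<^sup>2 * t = h' * b + t'"
    using four mult_left_cancel by blast
  moreover have "finite (loops D)"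
    using assms(6) by (simp add: oriented_link_diagram_def Let_def)
  ultimately interpret twist D h' t' h t a b
    using assms(4) lin by unfold_locales
  obtain w0 where w0: "w0 \<in> cocycles h' t' D i" "\<alpha> = coclass h' t' D i w0"
    using assms(7) by (auto simp: cohomology_def coclass_def elim: quotientE)
  have "twist_equivalence a h' h t D i \<alpha> = coclass h t D i (twist_cochain a b D w0)"
    unfolding twist_equivalence_def w0(2) b_def[symmetric] by (rule twist_image_coclass[OF w0(1)])
  then show ?thesis using s_grading_twist[OF w0(1)] w0(2) by simp
qed

end
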